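(* Let $m\in\mathbb{N}$, $N\in\mathbb{N}$, and let $\mathcal{G}$ be a fixed connected undirected graph on the node set $\mathcal{I}=\{1,\dots,N\}$ with adjacency matrix $(a_{ij})$, $a_{ij}\in\{0,1\}$. Let $k_0,\dots,k_m>0$ be EDCHO-admissible gains for $\mathcal{G}$ with $L=1$ (see context). Let $\kappa$ be an $m$-th order modulating function (see context) and put $K_\mu:=\sup_{t\in[0,1]}|\kappa^{(\mu)}(t)|$ for $\mu\in\{0,\dots,m+1\}$. Let $L_0,\dots,L_{m+1}>0$ and $T_{\min}>0$ be given, and set $$\theta=\sum_{\nu=0}^{m+1}\binom{m+1}{\nu}\frac{1}{T_{\min}^{\,m-\nu+1}}K_{m-\nu+1}L_\nu .$$ Let $T_c\ge T_{\min}$ be any deadline, and let $s_1,\dots,s_N:[0,\infty)\to\mathbb{R}$ be $(m+1)$-times differentiable signals with average $\bar s(t)=\frac1N\sum_{i=1}^N s_i(t)$ such that, for all $i\in\mathcal{I}$, $$\left|\bar s^{(\mu)}(t)-s_i^{(\mu)}(t)\right|\le L_\mu\quad \forall t\in[0,T_c],\ \forall\mu\in\{0,\dots,m+1\},$$ $$\left|\bar s^{(m+1)}(t)-s_i^{(m+1)}(t)\right|\le L_{m+1}\quad \forall t\ge T_c .$$ Consider the protocol, for $i\in\mathcal{I}$, $$\dot x_{i,\mu}=\theta^{\frac{\mu+1}{m+1}}k_\mu\sum_{j=1}^N a_{ij}\lceil y_{i,0}-y_{j,0}\rfloor^{\frac{m-\mu}{m+1}}+x_{i,\mu+1},\quad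 0\le\mu<m,$$ $$\dot x_{i,m}=\theta k_m\sum_{j=1}^N a_{ij}\lceil y_{i,0}-y_{j,0}\rfloor^{0},$$ $$y_{i,\mu}(t)=\sigma_i^{(\mu)}(t)-x_{i,\mu}(t),\quad 0\le\mu\le m,\qquad \sigma_i(t):=\kappa\!\left(\tfrac{t}{T_c}\right)s_i(t),$$ with initial conditions $x_{i,\mu}(0)=0$ for all $i\in\mathcal{I}$, $\mu\in\{0,\dots,m\}$. Then $$y_{i,\mu}(t)=\bar s^{(\mu)}(t)\qquad\forall t\ge T_c,\ \forall i\in\mathcal{I},\ \forall\mu\in\{0,\dots,m\}.$$
   Context: Notation: for $x\in\mathbb{R}$, $\lceil x\rfloor^\alpha:=|x|^\alpha\,\mathrm{sign}(x)$ if $\alpha>0$, and $\lceil x\rfloor^0:=\mathrm{sign}(x)$, where $\mathrm{sign}(x)=1,-1,0$ for $x>0$, $x<0$, $x=0$ respectively. Superscripts $(\mu)$ denote $\mu$-th derivatives in $t$. Differential equations with discontinuous right-hand side are understood in the sense of Filippov. Modulating function: a function $\kappa:[0,\infty)\to\mathbb{R}$ whose $(m+1)$-th derivative is continuous on $[0,\infty)$ is an $m$-th order modulating function if $\kappa(0)=0$, $\kappa(t)=1$ for all $t\ge1$, and $\kappa^{(\mu)}(0)=\kappa^{(\mu)}(1)=0$ for all $\mu\in\{1,\dots,m\}$. EDCHO-admissible gains: given $\mathcal{G}$ and $L>0$, the gains $k_0,\dots,k_m>0$ are EDCHO-admissible for $\mathcal{G}$ with $L$ if the following known convergence property of the EDCHO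 protocol holds. For $(m+1)$-times differentiable signals $\tilde\sigma_1,\dots,\tilde\sigma_N:[0,\infty)\to\mathbb{R}$ with average $\bar\sigma=\frac1N\sum_{i=1}^N\tilde\sigma_i$, consider $$\dot{\tilde x}_{i,\mu}=k_\mu\sum_{j=1}^N a_{ij}\lceil\tilde y_{i,0}-\tilde y_{j,0}\rfloor^{\frac{m-\mu}{m+1}}+\tilde x_{i,\mu+1}\ (0\le\mu<m),\qquad \dot{\tilde x}_{i,m}=k_m\sum_{j=1}^N a_{ij}\lceil\tilde y_{i,0}-\tilde y_{j,0}\rfloor^{0},$$ $$\tilde y_{i,\mu}=\tilde\sigma_i^{(\mu)}-\tilde x_{i,\mu}.$$ Whenever $|\bar\sigma^{(m+1)}(t)-\tilde\sigma_i^{(m+1)}(t)|\le L$ for all $t\ge0$ and all $i$, and $\sum_{i=1}^N\tilde x_{i,\mu}(0)=0$ for all $\mu\in\{0,\dots,m\}$, there is a time $T>0$, depending only on the initial conditions $\tilde y_{i,\mu}(0)$ ($i\in\mathcal{I}$, $0\le\mu\le m$) and on the gains $k_0,\dots,k_m$, such that $\tilde y_{i,\mu}(t)=\bar\sigma^{(\mu)}(t)$ for all $t\ge T$, all $i\in\mathcal{I}$ and all $\mu\in\{0,\dots,m\}$. *)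

theory Defs
  imports "HOL-Analysis.Analysis"
begin

definition spow :: "real \<Rightarrow> real \<Rightarrow> real" where
  "spow x \<alpha> = (if \<alpha> = 0 then sgn x else \<bar>x\<bar> powr \<alpha> * sgn x)"

text \<open>
  Signals live on the half-line \<open>[0,\<infinity>)\<close>: derivatives are taken within \<open>{0..}\<close>, hence are
  one-sided at \<open>0\<close> and do not see the values of the function at negative arguments.
\<close>

definition nderiv :: "nat \<Rightarrow> (real \<Rightarrow> real) \<Rightarrow> real \<Rightarrow> real" where
  "nderiv n = ((\<lambda>g t. vector_derivative g (at t within {0..})) ^^ n)"

definition times_differentiable :: "nat \<Rightarrow> (real \<Rightarrow> real) \<Rightarrow> bool" where
  "times_differentiable n g \<longleftrightarrow> (\<forall>\<mu><n. nderiv \<mu> g differentiable_on {0..})"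

definition modulating_function :: "nat \<Rightarrow> (real \<Rightarrow> real) \<Rightarrow> bool" where
  "modulating_function m \<kappa> \<longleftrightarrow>
     times_differentiable (m + 1) \<kappa> \<and> continuous_on {0..} (nderiv (m + 1) \<kappa>) \<and>
     \<kappa> 0 = 0 \<and> (\<forall>t\<ge>1. \<kappa> t = 1) \<and>
     (\<forall>\<mu>\<in>{1..m}. nderiv \<mu> \<kappa> 0 = 0 \<and> nderiv \<mu> \<kappa> 1 = 0)"

definition average :: "nat \<Rightarrow> (nat \<Rightarrow> real \<Rightarrow> real) \<Rightarrow> real \<Rightarrow> real" where
  "average N s t = 1 / real N * (\<Sum>i=1..N. s i t)"

text \<open>
  A connected undirected graph on \<open>{1..N}\<close>, given by its adjacency matrix. The diagonal is left
  unconstrained: self-loops contribute \<open>spow 0 \<alpha> = 0\<close> to the protocols below.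
\<close>

definition connected_undirected_graph :: "nat \<Rightarrow> (nat \<Rightarrow> nat \<Rightarrow> real) \<Rightarrow> bool" where
  "connected_undirected_graph N a \<longleftrightarrow>
     (\<forall>i\<in>{1..N}. \<forall>j\<in>{1..N}. a i j \<in> {0, 1} \<and> a i j = a j i) \<and>
     (\<forall>i\<in>{1..N}. \<forall>j\<in>{1..N}. (i, j) \<in> {(p, q). p \<in> {1..N} \<and> q \<in> {1..N} \<and> a p q = 1}\<^sup>*)"


subsection \<open>Filippov solutions\<close>

text \<open>
  The state space is \<open>\<real>\<^sup>I\<close> for a finite index set \<open>I\<close>, represented by functions \<open>'i \<Rightarrow> real\<close> of which
  only the values on \<open>I\<close> matter; \<^term>\<open>L2_set x I\<close> is the Euclidean norm. Such functions do not form
  an instance of the vector space classes, so the closure of the convex hull (finite convex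
  combinations, then limits) is written out; \<open>closed_convex_hull_on_vec\<close> relates it to the library.
\<close>

definition closed_convex_hull_on :: "'i set \<Rightarrow> ('i \<Rightarrow> real) set \<Rightarrow> ('i \<Rightarrow> real) set" where
  "closed_convex_hull_on I S =
     {v. \<forall>\<epsilon>>0. \<exists>(n::nat) c u. (\<forall>k<n. c k \<ge> 0 \<and> u k \<in> S) \<and> (\<Sum>k<n. c k) = 1 \<and>
           L2_set (\<lambda>i. v i - (\<Sum>k<n. c k * u k i)) I < \<epsilon>}"

text \<open>
  Filippov's set-valued map: the intersection, over all radii \<open>\<delta> > 0\<close> and all null sets \<open>Z\<close>, of the
  closed convex hulls of \<open>f(t, B(x,\<delta>) \ Z)\<close>. Borel null sets suffice, because every Lebesgue null
  set is contained in one and enlarging \<open>Z\<close> shrinks the hull.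
\<close>

definition filippov_set ::
  "'i set \<Rightarrow> (real \<Rightarrow> ('i \<Rightarrow> real) \<Rightarrow> 'i \<Rightarrow> real) \<Rightarrow> real \<Rightarrow> ('i \<Rightarrow> real) \<Rightarrow> ('i \<Rightarrow> real) set" where
  "filippov_set I f t x =
     (\<Inter>\<delta>\<in>{0<..}. \<Inter>Z\<in>null_sets (Pi\<^sub>M I (\<lambda>_. lborel)).
        closed_convex_hull_on I
          (f t ` ({z \<in> space (Pi\<^sub>M I (\<lambda>_. lborel)). L2_set (\<lambda>i. z i - x i) I < \<delta>} - Z)))"

definition abs_continuous_on_interval :: "real \<Rightarrow> real \<Rightarrow> (real \<Rightarrow> real) \<Rightarrow> bool" where
  "abs_continuous_on_interval a b g \<longleftrightarrow>
     (\<forall>\<epsilon>>0. \<exists>\<delta>>0. \<forall>(n::nat) u v.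
        (\<forall>k<n. a \<le> u k \<and> u k \<le> v k \<and> v k \<le> b) \<and>
        disjoint_family_on (\<lambda>k. {u k<..<v k}) {..<n} \<and>
        (\<Sum>k<n. v k - u k) < \<delta> \<longrightarrow>
        (\<Sum>k<n. \<bar>g (v k) - g (u k)\<bar>) < \<epsilon>)"

definition filippov_solution ::
  "'i set \<Rightarrow> (real \<Rightarrow> ('i \<Rightarrow> real) \<Rightarrow> 'i \<Rightarrow> real) \<Rightarrow> (real \<Rightarrow> 'i \<Rightarrow> real) \<Rightarrow> bool" where
  "filippov_solution I f x \<longleftrightarrow>
     (\<forall>i\<in>I. \<forall>b>0. abs_continuous_on_interval 0 b (\<lambda>t. x t i)) \<and>
     (AE t in lborel. t > 0 \<longrightarrow>
        (\<exists>v\<in>filippov_set I f t (x t). \<forall>i\<in>I. ((\<lambda>\<tau>. x \<tau> i) has_real_derivative v i) (at t)))"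


subsection \<open>The consensus protocols\<close>

definition protocol_index :: "nat \<Rightarrow> nat \<Rightarrow> (nat \<times> nat) set" where
  "protocol_index m N = {1..N} \<times> {0..m}"

text \<open>
  The component \<open>(i,\<mu>)\<close> of a state is the variable \<open>x\<^sub>i\<^sub>,\<^sub>\<mu>\<close>, and the arguments of \<^const>\<open>spow\<close> are the
  differences \<open>y\<^sub>i\<^sub>,\<^sub>0 - y\<^sub>j\<^sub>,\<^sub>0\<close> with \<open>y\<^sub>i\<^sub>,\<^sub>0 = \<sigma>\<^sub>i - x\<^sub>i\<^sub>,\<^sub>0\<close>. For \<open>\<mu> = m\<close> the exponent is \<open>0\<close>. The weights \<open>w\<close> are
  \<open>k\<^sub>\<mu>\<close> in one protocol and \<open>\<theta> powr ((\<mu>+1)/(m+1)) * k\<^sub>\<mu>\<close> in the other.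
\<close>

definition protocol_rhs ::
  "nat \<Rightarrow> nat \<Rightarrow> (nat \<Rightarrow> nat \<Rightarrow> real) \<Rightarrow> (nat \<Rightarrow> real) \<Rightarrow> (nat \<Rightarrow> real \<Rightarrow> real) \<Rightarrow>
   real \<Rightarrow> (nat \<times> nat \<Rightarrow> real) \<Rightarrow> nat \<times> nat \<Rightarrow> real" where
  "protocol_rhs m N a w \<sigma> t x = (\<lambda>(i, \<mu>).
     w \<mu> * (\<Sum>j=1..N. a i j *
        spow ((\<sigma> i t - x (i, 0)) - (\<sigma> j t - x (j, 0))) (real (m - \<mu>) / real (m + 1)))
     + (if \<mu> < m then x (i, \<mu> + 1) else 0))"

definition protocol_output ::
  "(nat \<Rightarrow> real \<Rightarrow> real) \<Rightarrow> (real \<Rightarrow> nat \<times> nat \<Rightarrow> real) \<Rightarrow> nat \<Rightarrow> nat \<Rightarrow> real \<Rightarrow> real" where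
  "protocol_output \<sigma> x i \<mu> t = nderiv \<mu> (\<sigma> i) t - x t (i, \<mu>)"

text \<open>
  The time \<open>T\<close> is chosen after the initial outputs \<open>y0\<close> but before the signals and the
  trajectory: this is the requirement that it depend on the initial conditions and gains only.
\<close>

definition edcho_admissible ::
  "nat \<Rightarrow> nat \<Rightarrow> (nat \<Rightarrow> nat \<Rightarrow> real) \<Rightarrow> real \<Rightarrow> (nat \<Rightarrow> real) \<Rightarrow> bool" where
  "edcho_admissible m N a L k \<longleftrightarrow>
     (\<forall>\<mu>\<le>m. k \<mu> > 0) \<and>
     (\<forall>y0 :: nat \<Rightarrow> nat \<Rightarrow> real. \<exists>T>0. \<forall>\<sigma> x.
        (\<forall>i\<in>{1..N}. times_differentiable (m + 1) (\<sigma> i)) \<and>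
        (\<forall>t\<ge>0. \<forall>i\<in>{1..N}.
           \<bar>nderiv (m + 1) (average N \<sigma>) t - nderiv (m + 1) (\<sigma> i) t\<bar> \<le> L) \<and>
        filippov_solution (protocol_index m N) (protocol_rhs m N a k \<sigma>) x \<and>
        (\<forall>\<mu>\<le>m. (\<Sum>i=1..N. x 0 (i, \<mu>)) = 0) \<and>
        (\<forall>i\<in>{1..N}. \<forall>\<mu>\<le>m. protocol_output \<sigma> x i \<mu> 0 = y0 i \<mu>) \<longrightarrow>
        (\<forall>t\<ge>T. \<forall>i\<in>{1..N}. \<forall>\<mu>\<le>m.
           protocol_output \<sigma> x i \<mu> t = nderiv \<mu> (average N \<sigma>) t))"


subsection \<open>Agreement with the library's closed convex hull\<close>

lemma closed_convex_hull_on_vec: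
  fixes S :: "(real ^ 'n) set"
  shows "closed_convex_hull_on UNIV (($) ` S) = ($) ` closure (convex hull S)"
proof -
  have hull: "y \<in> convex hull S \<longleftrightarrow>
      (\<exists>(n::nat) c u. (\<forall>k<n. c k \<ge> 0 \<and> u k \<in> S) \<and> (\<Sum>k<n. c k) = 1 \<and>
         y = (\<Sum>k<n. c k *\<^sub>R u k))" (is "_ \<longleftrightarrow> ?R y") for y :: "real ^ 'n"
  proof
    assume "y \<in> convex hull S"
    then obtain n c u where *: "\<forall>i\<in>{1..n::nat}. 0 \<le> c i \<and> u i \<in> S" "sum c {1..n} = 1"
        "(\<Sum>i=1..n. c i *\<^sub>R u i) = y"
      unfolding convex_hull_indexed by auto
    have shift: "(\<Sum>k<n. h (Suc k)) = sum h {1..n}" for h :: "nat \<Rightarrow> 'x::comm_monoid_add"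
      by (simp add: sum.atLeast1_atMost_eq)
    show "?R y"
      by (rule exI[of _ n], rule exI[of _ "\<lambda>k. c (Suc k)"], rule exI[of _ "\<lambda>k. u (Suc k)"])
        (use * in \<open>auto simp: shift[of c] shift[of "\<lambda>k. c k *\<^sub>R u k"]\<close>)
  next
    assume "?R y"
    then obtain n :: nat and c u where *: "\<forall>k<n. c k \<ge> 0 \<and> u k \<in> S" "(\<Sum>k<n. c k) = 1"
        "y = (\<Sum>k<n. c k *\<^sub>R u k)"
      by blast
    show "y \<in> convex hull S"
      unfolding *(3)
      by (rule convex_sum[OF _ convex_convex_hull]) (use * in \<open>auto intro: hull_inc\<close>)
  qed
  have mem: "($) w \<in> closed_convex_hull_on UNIV (($) ` S) \<longleftrightarrow> w \<in> closure (convex hull S)"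
    (is "?A \<longleftrightarrow> ?B") for w
  proof
    assume ?A
    show ?B
      unfolding closure_approachable
    proof (intro allI impI)
      fix e :: real assume "e > 0"
      with \<open>?A\<close> obtain n :: nat and c u where *: "\<forall>k<n. c k \<ge> 0 \<and> u k \<in> ($) ` S"
          "(\<Sum>k<n. c k) = 1" "L2_set (\<lambda>i. w $ i - (\<Sum>k<n. c k * u k i)) UNIV < e"
        unfolding closed_convex_hull_on_def by blast
      define u' where "u' k = vec_lambda (u k)" for k
      have u': "u' k \<in> S" if "k < n" for k
        using * that by (auto simp: u'_def)
      have "(\<Sum>k<n. c k *\<^sub>R u' k) \<in> convex hull S"
        unfolding hull using * u' by blast
      moreover have "dist (\<Sum>k<n. c k *\<^sub>R u' k) w < e"
        using *(3) by (subst dist_commute) (simp add: dist_norm norm_vec_def L2_set_def u'_def)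
      ultimately show "\<exists>y\<in>convex hull S. dist y w < e" by blast
    qed
  next
    assume ?B
    show ?A
      unfolding closed_convex_hull_on_def
    proof (intro CollectI allI impI)
      fix e :: real assume "e > 0"
      with \<open>?B\<close> obtain y where y: "y \<in> convex hull S" "dist y w < e"
        unfolding closure_approachable by blast
      from y(1) obtain n :: nat and c u where *: "\<forall>k<n. c k \<ge> 0 \<and> u k \<in> S"
          "(\<Sum>k<n. c k) = 1" "y = (\<Sum>k<n. c k *\<^sub>R u k)"
        unfolding hull by blast
      have "L2_set (\<lambda>i. w $ i - (\<Sum>k<n. c k * u k $ i)) UNIV < e"
        using y(2) *(3) by (subst (asm) dist_commute) (simp add: dist_norm norm_vec_def L2_set_def)
      with * show "\<exists>(n::nat) c v. (\<forall>k<n. c k \<ge> 0 \<and> v k \<in> ($) ` S) \<and> (\<Sum>k<n. c k) = 1 \<and>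
          L2_set (\<lambda>i. w $ i - (\<Sum>k<n. c k * v k i)) UNIV < e"
        by (intro exI[of _ n] exI[of _ c] exI[of _ "\<lambda>k. ($) (u k)"]) auto
    qed
  qed
  show ?thesis
  proof (intro set_eqI)
    fix v :: "'n \<Rightarrow> real"
    have v: "v = ($) (vec_lambda v)" by auto
    have inj: "($) x = ($) y \<longleftrightarrow> x = y" for x y :: "real ^ 'n" by (auto simp: vec_eq_iff fun_eq_iff)
    show "v \<in> closed_convex_hull_on UNIV (($) ` S) \<longleftrightarrow> v \<in> ($) ` closure (convex hull S)"
      by (subst (1 2) v) (auto simp: mem image_iff inj simp del: vec_lambda_inverse vec_lambda_beta)
  qed
qed

end

theory Submission
  imports Defs
begin

text \<open>
  The modulating function makes all initial outputs vanish, and the vanishing initial state is fixed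
  by the homogeneity of the protocol: for every \<open>l > 0\<close>, the trajectory
  \<open>l\<^sup>m\<^sup>+\<^sup>1\<^sup>-\<^sup>\<mu> / \<theta> * x\<^sub>i\<^sub>,\<^sub>\<mu>(t / l)\<close> solves EDCHO for the signals \<open>l\<^sup>m\<^sup>+\<^sup>1 / \<theta> * \<sigma>\<^sub>i(t / l)\<close>, whose top
  derivatives do not depend on \<open>l\<close> in magnitude and deviate from their average by at most \<open>1\<close>, by the
  Leibniz rule and the choice of \<open>\<theta>\<close>. The settling time \<open>T\<close> for zero initial outputs is therefore the
  same for all \<open>l\<close>, so in the original time scale the settling time is at most \<open>T / l\<close>; taking
  \<open>l = T / T\<^sub>c\<close> suffices. After \<open>T\<^sub>c\<close> the modulating factor is \<open>1\<close>, so the averages agree.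
\<close>

subsection \<open>Iterated derivatives on the half-line\<close>

lemma nderiv_0 [simp]: "nderiv 0 g = g"
  by (simp add: nderiv_def)

lemma nderiv_Suc:
  "nderiv (Suc n) g t = vector_derivative (nderiv n g) (at t within {0..})"
  by (simp add: nderiv_def)

text \<open>The choice operator behind \<open>vector_derivative\<close> returns \<open>d\<close>
  because derivatives within the half-line are unique: every \<open>t \<ge> 0\<close> is a limit
  point of it, as the segment \<open>{t..t + 1}\<close> shows.\<close>

lemma vector_derivative_halfline:
  assumes "(g has_real_derivative d) (at t within {0..})" "t \<ge> 0"
  shows "vector_derivative g (at t within {0..}) = d"
proof (rule vector_derivative_within)
  show "at t within {0..} \<noteq> bot"
    using islimpt_subset[of t "{t..t + 1}" "{0..}"] \<open>t \<ge> 0\<close> by (simp add: trivial_limit_within)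
  show "(g has_vector_derivative d) (at t within {0..})"
    using assms by (simp add: has_real_derivative_iff_has_vector_derivative)
qed

lemma nderiv_has_derivative:
  assumes "times_differentiable n g" "\<mu> < n" "t \<ge> 0"
  shows "(nderiv \<mu> g has_real_derivative nderiv (Suc \<mu>) g t) (at t within {0..})"
proof -
  have "nderiv \<mu> g differentiable (at t within {0..})"
    using assms by (auto simp: times_differentiable_def differentiable_on_def)
  then obtain d where "(nderiv \<mu> g has_real_derivative d) (at t within {0..})"
    by (auto simp: real_differentiable_def)
  then show ?thesis
    using vector_derivative_halfline assms(3) by (metis nderiv_Suc)
qed

text \<open>Recognition principle: a family \<open>F\<close> that starts at \<open>g\<close> and in
  which each member differentiates to the next is identified with \<open>nderiv\<close> by
  induction. Rescalings, averages and products below only have to supply their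
  \<open>F\<close>.\<close>

lemma nderiv_unique:
  assumes base: "\<And>t. t \<ge> 0 \<Longrightarrow> F 0 t = g t"
    and step: "\<And>\<mu> t. \<mu> < n \<Longrightarrow> t \<ge> 0 \<Longrightarrow> (F \<mu> has_real_derivative F (Suc \<mu>) t) (at t within {0..})"
  shows "\<mu> \<le> n \<Longrightarrow> t \<ge> 0 \<Longrightarrow> nderiv \<mu> g t = F \<mu> t"
    and "times_differentiable n g"
proof -
  have main: "(\<forall>t\<ge>0. nderiv \<mu> g t = F \<mu> t)" if "\<mu> \<le> n" for \<mu>
    using that
  proof (induction \<mu>)
    case 0
    then show ?case by (simp add: base)
  next
    case (Suc \<mu>)
    \<comment> \<open>By the induction hypothesis \<open>nderiv \<mu> g\<close> and
      \<open>F \<mu>\<close> agree on the whole half-line, so any radius serves for the local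
      transfer of the derivative.\<close>
    have "(nderiv \<mu> g has_real_derivative F (Suc \<mu>) t) (at t within {0..})" if "t \<ge> 0" for t
      by (rule has_field_derivative_transform_within[OF step zero_less_one]) (use Suc that in auto)
    then show ?case by (auto simp: nderiv_Suc intro!: vector_derivative_halfline)
  qed
  then show "\<mu> \<le> n \<Longrightarrow> t \<ge> 0 \<Longrightarrow> nderiv \<mu> g t = F \<mu> t" by blast
  have "(nderiv \<mu> g has_real_derivative F (Suc \<mu>) t) (at t within {0..})" if "\<mu> < n" "t \<ge> 0" for \<mu> t
    by (rule has_field_derivative_transform_within[OF step zero_less_one]) (use main[of \<mu>] that in auto)
  then show "times_differentiable n g"
    unfolding times_differentiable_def differentiable_on_def real_differentiable_def by auto
qed

text \<open>The chain rule applies up to the endpoint \<open>0\<close> because division by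
  \<open>c > 0\<close> maps the half-line into itself. The lemma serves the passage from
  \<open>\<kappa>\<close> to the deadline \<open>T_c\<close> as well as the homogeneity
  scaling.\<close>

lemma nderiv_rescale:
  assumes g: "times_differentiable n g" and "c > 0"
  shows "\<mu> \<le> n \<Longrightarrow> t \<ge> 0 \<Longrightarrow> nderiv \<mu> (\<lambda>t. r * g (t / c)) t = r / c ^ \<mu> * nderiv \<mu> g (t / c)"
    and "times_differentiable n (\<lambda>t. r * g (t / c))"
proof -
  define F where "F \<mu> t = r / c ^ \<mu> * nderiv \<mu> g (t / c)" for \<mu> t
  have base: "F 0 t = r * g (t / c)" for t by (simp add: F_def)
  have step: "(F \<mu> has_real_derivative F (Suc \<mu>) t) (at t within {0..})" if "\<mu> < n" "t \<ge> 0" for \<mu> t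
  proof -
    have im: "(\<lambda>t. t / c) ` {0..} \<subseteq> {0..}" using \<open>c > 0\<close> by auto
    have "(nderiv \<mu> g has_real_derivative nderiv (Suc \<mu>) g (t / c)) (at (t / c) within (\<lambda>t. t / c) ` {0..})"
      by (rule DERIV_subset[OF nderiv_has_derivative[OF g] im]) (use that \<open>c > 0\<close> in auto)
    moreover have "((\<lambda>t. t / c) has_real_derivative 1 / c) (at t within {0..})"
      using \<open>c > 0\<close> by (auto intro!: derivative_eq_intros)
    ultimately have "((\<lambda>t. nderiv \<mu> g (t / c)) has_real_derivative nderiv (Suc \<mu>) g (t / c) * (1 / c))
        (at t within {0..})"
      by (rule DERIV_image_chain[of "nderiv \<mu> g" _ "\<lambda>t. t / c", unfolded o_def])
    from DERIV_cmult[OF this, of "r / c ^ \<mu>"] show ?thesis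
      unfolding F_def by (simp add: mult_ac)
  qed
  show "\<mu> \<le> n \<Longrightarrow> t \<ge> 0 \<Longrightarrow> nderiv \<mu> (\<lambda>t. r * g (t / c)) t = r / c ^ \<mu> * nderiv \<mu> g (t / c)"
    using nderiv_unique(1)[of F, OF base step] by (simp add: F_def)
  show "times_differentiable n (\<lambda>t. r * g (t / c))"
    using nderiv_unique(2)[of F, OF base step] .
qed

lemma nderiv_average:
  assumes "\<forall>i\<in>{1..N}. times_differentiable n (s i)"
  shows "\<mu> \<le> n \<Longrightarrow> t \<ge> 0 \<Longrightarrow> nderiv \<mu> (average N s) t = 1 / real N * (\<Sum>i=1..N. nderiv \<mu> (s i) t)"
    and "times_differentiable n (average N s)"
proof -
  define F where "F \<mu> t = 1 / real N * (\<Sum>i=1..N. nderiv \<mu> (s i) t)" for \<mu> t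
  have base: "F 0 t = average N s t" for t by (simp add: F_def average_def)
  have step: "(F \<mu> has_real_derivative F (Suc \<mu>) t) (at t within {0..})" if "\<mu> < n" "t \<ge> 0" for \<mu> t
    unfolding F_def
    by (intro DERIV_cmult DERIV_sum nderiv_has_derivative[of n]) (use assms that in auto)
  show "\<mu> \<le> n \<Longrightarrow> t \<ge> 0 \<Longrightarrow> nderiv \<mu> (average N s) t = 1 / real N * (\<Sum>i=1..N. nderiv \<mu> (s i) t)"
    using nderiv_unique(1)[of F, OF base step] by (simp add: F_def)
  show "times_differentiable n (average N s)"
    using nderiv_unique(2)[of F, OF base step] .
qed

text \<open>Pascal's rule, in the form of the induction step of the Leibniz formula:
  \<open>f\<close> and \<open>g\<close> list the derivatives of the two factors at one fixed
  point.\<close>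

lemma leibniz_step:
  fixes f g :: "nat \<Rightarrow> real"
  shows "(\<Sum>\<nu>\<le>n. real (n choose \<nu>) * (f (Suc (n - \<nu>)) * g \<nu> + f (n - \<nu>) * g (Suc \<nu>))) =
         (\<Sum>\<nu>\<le>Suc n. real (Suc n choose \<nu>) * (f (Suc n - \<nu>) * g \<nu>))"
proof -
  \<comment> \<open>The additional index \<open>Suc n\<close> is harmless since
    \<open>n choose Suc n\<close> is \<open>0\<close>; splitting off the index \<open>0\<close> then
    aligns this half of the sum with the other one.\<close>
  have "(\<Sum>\<nu>\<le>n. real (n choose \<nu>) * (f (Suc (n - \<nu>)) * g \<nu>)) =
        (\<Sum>\<nu>\<le>Suc n. real (n choose \<nu>) * (f (Suc n - \<nu>) * g \<nu>))"
    by (auto intro!: sum.cong simp: Suc_diff_le)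
  also have "\<dots> = f (Suc n) * g 0 + (\<Sum>\<nu>\<le>n. real (n choose Suc \<nu>) * (f (n - \<nu>) * g (Suc \<nu>)))"
    by (subst sum.atMost_Suc_shift) simp
  finally have 1: "(\<Sum>\<nu>\<le>n. real (n choose \<nu>) * (f (Suc (n - \<nu>)) * g \<nu>)) = \<dots>" .
  show ?thesis
    unfolding distrib_left sum.distrib 1
    by (subst sum.atMost_Suc_shift) (simp add: sum.distrib algebra_simps)
qed

text \<open>The function \<open>h\<close> is kept apart from the product because the modulated
  signals are tied to it at nonnegative times only.\<close>

lemma nderiv_mult:
  assumes f: "times_differentiable n f" and g: "times_differentiable n g"
    and h: "\<And>t. t \<ge> 0 \<Longrightarrow> h t = f t * g t"
  shows "\<mu> \<le> n \<Longrightarrow> t \<ge> 0 \<Longrightarrow>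
      nderiv \<mu> h t = (\<Sum>\<nu>\<le>\<mu>. real (\<mu> choose \<nu>) * (nderiv (\<mu> - \<nu>) f t * nderiv \<nu> g t))"
    and "times_differentiable n h"
proof -
  define F where "F \<mu> t = (\<Sum>\<nu>\<le>\<mu>. real (\<mu> choose \<nu>) * (nderiv (\<mu> - \<nu>) f t * nderiv \<nu> g t))" for \<mu> t
  have base: "F 0 t = h t" if "t \<ge> 0" for t using h that by (simp add: F_def)
  have step: "(F \<mu> has_real_derivative F (Suc \<mu>) t) (at t within {0..})" if "\<mu> < n" "t \<ge> 0" for \<mu> t
  proof -
    have "(F \<mu> has_real_derivative (\<Sum>\<nu>\<le>\<mu>. real (\<mu> choose \<nu>) *
        (nderiv (Suc (\<mu> - \<nu>)) f t * nderiv \<nu> g t + nderiv (\<mu> - \<nu>) f t * nderiv (Suc \<nu>) g t)))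
        (at t within {0..})"
      unfolding F_def
    proof (intro DERIV_cmult DERIV_sum)
      fix \<nu> assume "\<nu> \<in> {..\<mu>}"
      then show "((\<lambda>t. nderiv (\<mu> - \<nu>) f t * nderiv \<nu> g t) has_real_derivative
          nderiv (Suc (\<mu> - \<nu>)) f t * nderiv \<nu> g t + nderiv (\<mu> - \<nu>) f t * nderiv (Suc \<nu>) g t)
          (at t within {0..})"
        using DERIV_mult[OF nderiv_has_derivative[OF f] nderiv_has_derivative[OF g], of "\<mu> - \<nu>" t \<nu>] that
        by (simp add: mult.commute)
    qed
    then show ?thesis
      unfolding leibniz_step[of \<mu> "\<lambda>\<nu>. nderiv \<nu> f t" "\<lambda>\<nu>. nderiv \<nu> g t"] F_def .
  qed
  show "\<mu> \<le> n \<Longrightarrow> t \<ge> 0 \<Longrightarrow>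
      nderiv \<mu> h t = (\<Sum>\<nu>\<le>\<mu>. real (\<mu> choose \<nu>) * (nderiv (\<mu> - \<nu>) f t * nderiv \<nu> g t))"
    using nderiv_unique(1)[of F, OF base step] by (simp add: F_def)
  show "times_differentiable n h"
    using nderiv_unique(2)[of F, OF base step] .
qed

text \<open>The inequality \<open>t > b\<close> is strict so that \<open>g\<close> is constant on a
  two-sided neighbourhood of \<open>t\<close>; at \<open>b\<close> itself the derivative may still
  see values on the left.\<close>

lemma nderiv_eventually_const:
  assumes "\<forall>t\<ge>b. g t = c" "b \<ge> 0" "t > b" "\<mu> > 0"
  shows "nderiv \<mu> g t = 0"
proof -
  have "\<forall>t>b. nderiv (Suc n) g t = 0" for n
  proof (induction n)
    case 0
    show ?case
    proof (intro allI impI)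
      fix t assume "t > b"
      have "(g has_real_derivative 0) (at t)"
        by (rule has_field_derivative_transform_within_open[OF DERIV_const[of c] open_greaterThan[of b]])
          (use assms(1) \<open>t > b\<close> in simp_all)
      from vector_derivative_halfline[OF has_field_derivative_at_within[OF this]]
      show "nderiv (Suc 0) g t = 0"
        using \<open>t > b\<close> \<open>b \<ge> 0\<close> by (simp add: nderiv_Suc)
    qed
  next
    case (Suc n)
    show ?case
    proof (intro allI impI)
      fix t assume "t > b"
      have "(nderiv (Suc n) g has_real_derivative 0) (at t)"
        by (rule has_field_derivative_transform_within_open[OF DERIV_const[of 0] open_greaterThan[of b]])
          (use Suc \<open>t > b\<close> in simp_all)
      from vector_derivative_halfline[OF has_field_derivative_at_within[OF this]]
      show "nderiv (Suc (Suc n)) g t = 0"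
        using \<open>t > b\<close> \<open>b \<ge> 0\<close> by (simp add: nderiv_Suc[of "Suc n"])
    qed
  qed
  with assms show ?thesis by (cases \<mu>) auto
qed

subsection \<open>Filippov solutions under rescaling\<close>

lemma L2_set_scale_le:
  assumes "\<And>i. i \<in> I \<Longrightarrow> \<bar>d i\<bar> \<le> M" "M \<ge> 0"
  shows "L2_set (\<lambda>i. d i * w i) I \<le> M * L2_set w I"
proof -
  have "L2_set (\<lambda>i. d i * w i) I = L2_set (\<lambda>i. \<bar>d i * w i\<bar>) I"
    by (simp add: L2_set_def)
  also have "\<dots> \<le> L2_set (\<lambda>i. M * \<bar>w i\<bar>) I"
    by (rule L2_set_mono) (use assms in \<open>auto simp: abs_mult intro!: mult_right_mono\<close>)
  also have "\<dots> = M * L2_set (\<lambda>i. \<bar>w i\<bar>) I" using assms(2) by (simp add: L2_set_right_distrib)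
  finally show ?thesis by (simp add: L2_set_def)
qed

text \<open>A diagonal linear map keeps the coefficients of convex combinations and is Lipschitz, so
  approximations survive it. Agreement of the images on \<open>I\<close> is enough because distances
  are measured there.\<close>

lemma closed_convex_hull_on_scale:
  assumes "finite I" and v: "v \<in> closed_convex_hull_on I S"
    and S: "\<And>u. u \<in> S \<Longrightarrow> \<exists>u'\<in>S'. \<forall>i\<in>I. u' i = d i * u i"
  shows "(\<lambda>i. d i * v i) \<in> closed_convex_hull_on I S'"
  unfolding closed_convex_hull_on_def
proof (intro CollectI allI impI)
  fix \<epsilon> :: real assume "\<epsilon> > 0"
  \<comment> \<open>A Lipschitz constant of the diagonal map; the summand \<open>1\<close> keeps it
    positive even if \<open>d\<close> vanishes on \<open>I\<close>.\<close>
  define M where "M = (\<Sum>i\<in>I. \<bar>d i\<bar>) + 1"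
  have M0: "M > 0" unfolding M_def by (meson abs_ge_zero add_nonneg_pos sum_nonneg zero_less_one)
  have M: "\<bar>d i\<bar> \<le> M" if "i \<in> I" for i
    using member_le_sum[of i I "\<lambda>i. \<bar>d i\<bar>"] \<open>finite I\<close> that unfolding M_def by simp
  from v \<open>\<epsilon> > 0\<close> M0 obtain n :: nat and c u where *: "\<forall>k<n. c k \<ge> 0 \<and> u k \<in> S" "(\<Sum>k<n. c k) = 1"
      "L2_set (\<lambda>i. v i - (\<Sum>k<n. c k * u k i)) I < \<epsilon> / M"
    unfolding closed_convex_hull_on_def by (blast dest: divide_pos_pos)
  have "\<forall>k\<in>{..<n}. \<exists>w. w \<in> S' \<and> (\<forall>i\<in>I. w i = d i * u k i)"
    using S *(1) by blast
  from bchoice[OF this] obtain u' where u': "\<forall>k<n. u' k \<in> S' \<and> (\<forall>i\<in>I. u' k i = d i * u k i)"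
    by auto
  have "L2_set (\<lambda>i. d i * v i - (\<Sum>k<n. c k * u' k i)) I =
        L2_set (\<lambda>i. d i * (v i - (\<Sum>k<n. c k * u k i))) I"
    by (rule L2_set_cong) (use u' in \<open>auto simp: right_diff_distrib sum_distrib_left mult_ac intro!: sum.cong\<close>)
  also have "\<dots> \<le> M * L2_set (\<lambda>i. v i - (\<Sum>k<n. c k * u k i)) I"
    by (rule L2_set_scale_le) (use M M0 in auto)
  also have "\<dots> < \<epsilon>" using *(3) M0 by (simp add: field_simps)
  finally show "\<exists>(n::nat) c u. (\<forall>k<n. c k \<ge> 0 \<and> u k \<in> S') \<and> (\<Sum>k<n. c k) = 1 \<and>
      L2_set (\<lambda>i. d i * v i - (\<Sum>k<n. c k * u k i)) I < \<epsilon>"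
    using * u' by blast
qed

lemma lborel_emeasure_scale:
  fixes c :: real
  assumes "c > 0" "A \<in> sets lborel"
  shows "ennreal c * emeasure lborel {z. c * z \<in> A} = emeasure lborel A"
proof -
  have "emeasure (distr lborel borel ((*) c)) A = emeasure lborel {z. c * z \<in> A}"
    by (subst emeasure_distr) (use assms in \<open>auto simp: vimage_def\<close>)
  moreover have "emeasure (distr lborel borel ((*) c)) A = ennreal (inverse c) * emeasure lborel A"
    using assms by (subst lborel_distr_mult) (auto simp: emeasure_density_const)
  moreover have "ennreal c * (ennreal (inverse c) * emeasure lborel A) = emeasure lborel A"
    using assms(1) by (simp add: mult.assoc[symmetric] ennreal_mult'[symmetric])
  ultimately show ?thesis by simp
qed

text \<open>The pushforward of Lebesgue measure under a positive diagonal dilation is a constant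
  multiple of it, so preimages of null sets are null. This allows the sets \<open>Z\<close> in
  Filippov's map to be pulled back.\<close>

lemma null_sets_PiM_lborel_scale:
  fixes c :: "'i \<Rightarrow> real"
  assumes "finite I" and c: "\<And>i. i \<in> I \<Longrightarrow> c i > 0"
    and Z: "Z \<in> null_sets (Pi\<^sub>M I (\<lambda>_. lborel))"
  shows "{z \<in> space (Pi\<^sub>M I (\<lambda>_. lborel)). (\<lambda>i\<in>I. c i * z i) \<in> Z} \<in> null_sets (Pi\<^sub>M I (\<lambda>_. lborel))"
proof -
  let ?P = "Pi\<^sub>M I (\<lambda>_. lborel :: real measure)"
  let ?D = "\<lambda>z. \<lambda>i\<in>I. c i * z i"
  interpret product_sigma_finite "\<lambda>_::'i. lborel :: real measure"
    by (simp add: product_sigma_finite_def lborel.sigma_finite_measure_axioms)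
  have D: "?D \<in> measurable ?P ?P" by measurable
  \<comment> \<open>The pushforward corrected by the Jacobian. Preimages of boxes are boxes, so the
    one-dimensional case gives agreement with the product measure on boxes, which determines that
    measure.\<close>
  define Q where "Q = scale_measure (\<Prod>i\<in>I. ennreal (c i)) (distr ?P ?P ?D)"
  have "?P = Q"
  proof (rule PiM_eqI[OF \<open>finite I\<close>, symmetric])
    show "sets Q = sets ?P" by (simp add: Q_def)
    fix A :: "'i \<Rightarrow> real set" assume A: "\<And>i. i \<in> I \<Longrightarrow> A i \<in> sets lborel"
    have "?D -` Pi\<^sub>E I A \<inter> space ?P = Pi\<^sub>E I (\<lambda>i. {z. c i * z \<in> A i})"
      by (auto simp: space_PiM PiE_iff)
    then have "emeasure Q (Pi\<^sub>E I A) =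
        (\<Prod>i\<in>I. ennreal (c i)) * emeasure ?P (Pi\<^sub>E I (\<lambda>i. {z. c i * z \<in> A i}))"
      unfolding Q_def emeasure_scale_measure
      by (subst emeasure_distr[OF D]) (use A \<open>finite I\<close> in \<open>auto intro!: sets_PiM_I_finite\<close>)
    also have "\<dots> = (\<Prod>i\<in>I. ennreal (c i)) * (\<Prod>i\<in>I. emeasure lborel {z. c i * z \<in> A i})"
    proof (subst emeasure_PiM[OF \<open>finite I\<close>])
      fix i assume "i \<in> I"
      have "(*) (c i) -` A i \<inter> space borel \<in> sets borel"
        by (rule measurable_sets[of _ _ borel]) (use A \<open>i \<in> I\<close> in auto)
      then show "{z. c i * z \<in> A i} \<in> sets lborel" by (simp add: vimage_def)
    qed simp
    also have "\<dots> = (\<Prod>i\<in>I. emeasure lborel (A i))"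
      unfolding prod.distrib[symmetric]
      by (rule prod.cong) (use A c in \<open>auto intro!: lborel_emeasure_scale\<close>)
    finally show "emeasure Q (Pi\<^sub>E I A) = (\<Prod>i\<in>I. emeasure lborel (A i))" .
  qed
  then have "emeasure Q Z = 0" using Z by auto
  moreover have Z': "Z \<in> sets ?P" using Z by auto
  moreover have "(\<Prod>i\<in>I. ennreal (c i)) \<noteq> 0" using c \<open>finite I\<close> by (simp add: prod_zero_iff) force
  ultimately have "emeasure ?P (?D -` Z \<inter> space ?P) = 0"
    unfolding Q_def emeasure_scale_measure emeasure_distr[OF D Z'] mult_eq_0_iff by blast
  moreover have "?D -` Z \<inter> space ?P \<in> sets ?P" by (rule measurable_sets[OF D Z'])
  moreover have "?D -` Z \<inter> space ?P = {z \<in> space ?P. ?D z \<in> Z}" by auto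
  ultimately show ?thesis by (simp add: null_sets_def)
qed

text \<open>A radius \<open>\<delta>\<close> and a null set \<open>Z\<close> for \<open>g\<close>
  are answered by the radius \<open>\<delta> / M\<close> and the preimage of \<open>Z\<close> for
  \<open>f\<close>; the hull of \<open>f\<close> over these contains \<open>v\<close>, and the
  diagonal map carries it into the hull of \<open>g\<close>. The factors \<open>d\<close> of the
  velocities differ from the factors \<open>c\<close> of the states since time is rescaled
  too.\<close>

lemma filippov_set_scale:
  assumes "finite I" and c: "\<And>p. p \<in> I \<Longrightarrow> c p > 0" and v: "v \<in> filippov_set I f t x"
    and fg: "\<And>z p. p \<in> I \<Longrightarrow> g t' (\<lambda>p\<in>I. c p * z p) p = d p * f t z p"
  shows "(\<lambda>p. d p * v p) \<in> filippov_set I g t' (\<lambda>p. c p * x p)"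
  unfolding filippov_set_def
proof (intro INT_I)
  let ?P = "Pi\<^sub>M I (\<lambda>_. lborel :: real measure)"
  fix \<delta> :: real and Z
  assume "\<delta> \<in> {0<..}" and Z: "Z \<in> null_sets ?P"
  define M where "M = (\<Sum>i\<in>I. \<bar>c i\<bar>) + 1"
  have M0: "M > 0" unfolding M_def by (meson abs_ge_zero add_nonneg_pos sum_nonneg zero_less_one)
  have M: "\<bar>c i\<bar> \<le> M" if "i \<in> I" for i
    using member_le_sum[of i I "\<lambda>i. \<bar>c i\<bar>"] \<open>finite I\<close> that unfolding M_def by simp
  define Z' where "Z' = {z \<in> space ?P. (\<lambda>i\<in>I. c i * z i) \<in> Z}"
  have Z': "Z' \<in> null_sets ?P"
    unfolding Z'_def by (rule null_sets_PiM_lborel_scale) (use assms Z in auto)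
  have "\<delta> / M \<in> {0<..}" using M0 \<open>\<delta> \<in> {0<..}\<close> by simp
  then have "v \<in> closed_convex_hull_on I (f t ` ({z \<in> space ?P. L2_set (\<lambda>i. z i - x i) I < \<delta> / M} - Z'))"
    using v Z' unfolding filippov_set_def by blast
  then show "(\<lambda>p. d p * v p) \<in> closed_convex_hull_on I
      (g t' ` ({z \<in> space ?P. L2_set (\<lambda>i. z i - c i * x i) I < \<delta>} - Z))"
  proof (rule closed_convex_hull_on_scale[OF \<open>finite I\<close>])
    fix u assume "u \<in> f t ` ({z \<in> space ?P. L2_set (\<lambda>i. z i - x i) I < \<delta> / M} - Z')"
    then obtain z where z: "u = f t z" "z \<in> space ?P" "L2_set (\<lambda>i. z i - x i) I < \<delta> / M" "z \<notin> Z'"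
      by auto
    define w where "w = (\<lambda>i\<in>I. c i * z i)"
    have "L2_set (\<lambda>i. w i - c i * x i) I = L2_set (\<lambda>i. c i * (z i - x i)) I"
      by (rule L2_set_cong) (auto simp: w_def algebra_simps)
    also have "\<dots> \<le> M * L2_set (\<lambda>i. z i - x i) I"
      by (rule L2_set_scale_le) (use M M0 in auto)
    also have "\<dots> < \<delta>" using z(3) M0 by (simp add: field_simps)
    finally have "L2_set (\<lambda>i. w i - c i * x i) I < \<delta>" .
    moreover have "w \<in> space ?P" "w \<notin> Z"
      using z by (auto simp: w_def Z'_def space_PiM)
    ultimately have "g t' w \<in> g t' ` ({z \<in> space ?P. L2_set (\<lambda>i. z i - c i * x i) I < \<delta>} - Z)"
      by blast
    moreover have "\<forall>i\<in>I. g t' w i = d i * u i" using fg z(1) by (simp add: w_def)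
    ultimately show "\<exists>u'\<in>g t' ` ({z \<in> space ?P. L2_set (\<lambda>i. z i - c i * x i) I < \<delta>} - Z).
        \<forall>i\<in>I. u' i = d i * u i" by blast
  qed
qed

lemma abs_continuous_on_interval_rescale:
  assumes g: "abs_continuous_on_interval 0 (b / l) g" and "l > 0"
  shows "abs_continuous_on_interval 0 b (\<lambda>t. r * g (t / l))"
  unfolding abs_continuous_on_interval_def
proof (intro allI impI)
  fix \<epsilon> :: real assume "\<epsilon> > 0"
  \<comment> \<open>The \<open>1\<close> in the denominator covers \<open>r = 0\<close>.\<close>
  then have "\<epsilon> / (\<bar>r\<bar> + 1) > 0" by (simp add: add_nonneg_pos)
  note g' = g[unfolded abs_continuous_on_interval_def, THEN spec, THEN mp, OF this]
  obtain \<delta> where "\<delta> > 0" and \<delta>: "\<forall>(n::nat) u v.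
        (\<forall>k<n. 0 \<le> u k \<and> u k \<le> v k \<and> v k \<le> b / l) \<and>
        disjoint_family_on (\<lambda>k. {u k<..<v k}) {..<n} \<and>
        (\<Sum>k<n. v k - u k) < \<delta> \<longrightarrow> (\<Sum>k<n. \<bar>g (v k) - g (u k)\<bar>) < \<epsilon> / (\<bar>r\<bar> + 1)"
    using g' by (elim exE conjE) (rule that)
  show "\<exists>\<delta>>0. \<forall>(n::nat) u v.
        (\<forall>k<n. 0 \<le> u k \<and> u k \<le> v k \<and> v k \<le> b) \<and>
        disjoint_family_on (\<lambda>k. {u k<..<v k}) {..<n} \<and>
        (\<Sum>k<n. v k - u k) < \<delta> \<longrightarrow>
        (\<Sum>k<n. \<bar>r * g (v k / l) - r * g (u k / l)\<bar>) < \<epsilon>"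
  proof (intro exI[of _ "\<delta> * l"] conjI allI impI, goal_cases)
    case 1
    show ?case using \<open>\<delta> > 0\<close> \<open>l > 0\<close> by simp
  next
    case (2 n u v)
    then have A: "\<forall>k<n. 0 \<le> u k \<and> u k \<le> v k \<and> v k \<le> b"
      and B: "disjoint_family_on (\<lambda>k. {u k<..<v k}) {..<n}" and C: "(\<Sum>k<n. v k - u k) < \<delta> * l"
      by auto
    have "disjoint_family_on (\<lambda>k. {u k / l<..<v k / l}) {..<n}"
      unfolding disjoint_family_on_def
    proof (intro ballI impI, rule ccontr)
      fix p q assume pq: "p \<in> {..<n}" "q \<in> {..<n}" "p \<noteq> q"
        and "{u p / l<..<v p / l} \<inter> {u q / l<..<v q / l} \<noteq> {}"
      then obtain z where "z \<in> {u p / l<..<v p / l}" "z \<in> {u q / l<..<v q / l}" by blast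
      then have "z * l \<in> {u p<..<v p} \<inter> {u q<..<v q}" using \<open>l > 0\<close> by (simp add: field_simps)
      with B pq show False unfolding disjoint_family_on_def by blast
    qed
    moreover have "(\<Sum>k<n. v k / l - u k / l) < \<delta>"
    proof -
      have "(\<Sum>k<n. v k / l - u k / l) = (\<Sum>k<n. v k - u k) / l"
        by (simp add: sum_divide_distrib diff_divide_distrib)
      also have "\<dots> < \<delta>" using C \<open>l > 0\<close> by (simp add: pos_divide_less_eq)
      finally show ?thesis .
    qed
    ultimately have "(\<Sum>k<n. \<bar>g (v k / l) - g (u k / l)\<bar>) < \<epsilon> / (\<bar>r\<bar> + 1)"
      using A \<open>l > 0\<close> by (intro \<delta>[rule_format] conjI) (auto intro: divide_right_mono)
    then have "(\<bar>r\<bar> + 1) * (\<Sum>k<n. \<bar>g (v k / l) - g (u k / l)\<bar>) < \<epsilon>"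
      by (simp add: field_simps pos_less_divide_eq add_nonneg_pos)
    moreover have "(\<Sum>k<n. \<bar>r * g (v k / l) - r * g (u k / l)\<bar>) =
        \<bar>r\<bar> * (\<Sum>k<n. \<bar>g (v k / l) - g (u k / l)\<bar>)"
      by (simp add: right_diff_distrib[symmetric] abs_mult sum_distrib_left)
    moreover have "(\<Sum>k<n. \<bar>g (v k / l) - g (u k / l)\<bar>) \<ge> 0" by (rule sum_nonneg) simp
    ultimately show ?case unfolding distrib_right by linarith
  qed
qed

lemma AE_lborel_divide:
  fixes l :: real
  assumes "AE t in lborel. P t" "l > 0"
  shows "AE t in lborel. P (t / l)"
proof -
  \<comment> \<open>\<open>P\<close> is not assumed measurable, so the exceptional set is replaced
    by a measurable null superset before the affine substitution.\<close>
  obtain Z where Z: "{t \<in> space lborel. \<not> P t} \<subseteq> Z" "emeasure lborel Z = 0" "Z \<in> sets lborel"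
    using assms(1) by (rule AE_E)
  have [measurable]: "Z \<in> sets borel" using Z(3) by simp
  have "AE t in lborel. t \<notin> Z" using Z by (intro AE_not_in) (auto simp: null_sets_def)
  then have "AE t in lborel. 0 + inverse l * t \<notin> Z"
    by (intro AE_borel_affine) (use assms(2) in auto)
  then show ?thesis
    using Z(1) by (rule_tac AE_mp) (auto simp: field_simps)
qed

text \<open>Stretching time by \<open>l\<close> and component \<open>p\<close> by \<open>c p\<close>
  multiplies velocities by \<open>c p / l\<close>, by the chain rule; \<open>fg\<close> demands the
  same of the right-hand sides. The restriction to \<open>I\<close> in \<open>fg\<close> produces
  points of the product space.\<close>

lemma filippov_solution_rescale:
  assumes "finite I" "l > 0" and c: "\<And>p. p \<in> I \<Longrightarrow> c p > 0" and x: "filippov_solution I f x"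
    and fg: "\<And>t z p. p \<in> I \<Longrightarrow> g t (\<lambda>p\<in>I. c p * z p) p = c p / l * f (t / l) z p"
  shows "filippov_solution I g (\<lambda>t p. c p * x (t / l) p)"
  unfolding filippov_solution_def
proof (intro conjI ballI allI impI)
  fix p and b :: real assume "p \<in> I" "b > 0"
  then show "abs_continuous_on_interval 0 b (\<lambda>t. c p * x (t / l) p)"
    using x \<open>l > 0\<close> unfolding filippov_solution_def
    by (intro abs_continuous_on_interval_rescale) auto
next
  have "AE t in lborel. t / l > 0 \<longrightarrow>
      (\<exists>v\<in>filippov_set I f (t / l) (x (t / l)).
        \<forall>i\<in>I. ((\<lambda>\<tau>. x \<tau> i) has_real_derivative v i) (at (t / l)))"
    using AE_lborel_divide x \<open>l > 0\<close> unfolding filippov_solution_def by blast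
  then show "AE t in lborel. t > 0 \<longrightarrow>
      (\<exists>v\<in>filippov_set I g t (\<lambda>p. c p * x (t / l) p).
        \<forall>i\<in>I. ((\<lambda>\<tau>. c i * x (\<tau> / l) i) has_real_derivative v i) (at t))"
  proof eventually_elim
    case (elim t)
    show ?case
    proof
      assume "t > 0"
      then obtain v where v: "v \<in> filippov_set I f (t / l) (x (t / l))"
          "\<forall>i\<in>I. ((\<lambda>\<tau>. x \<tau> i) has_real_derivative v i) (at (t / l))"
        using elim \<open>l > 0\<close> by auto
      have member: "(\<lambda>p. c p / l * v p) \<in> filippov_set I g t (\<lambda>p. c p * x (t / l) p)"
        by (rule filippov_set_scale[where f = f and t = "t / l"]) (use assms v in auto)
      have velocity: "\<forall>i\<in>I. ((\<lambda>\<tau>. c i * x (\<tau> / l) i) has_real_derivative c i / l * v i) (at t)"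
      proof
        fix i assume "i \<in> I"
        have "((\<lambda>t. t / l) has_real_derivative 1 / l) (at t)"
          using \<open>l > 0\<close> by (auto intro!: derivative_eq_intros)
        then have "((\<lambda>\<tau>. x (\<tau> / l) i) has_real_derivative v i * (1 / l)) (at t)"
          by (rule DERIV_chain2[of "\<lambda>\<tau>. x \<tau> i", rotated]) (use v(2) \<open>i \<in> I\<close> in blast)
        from DERIV_cmult[OF this, of "c i"]
        show "((\<lambda>\<tau>. c i * x (\<tau> / l) i) has_real_derivative c i / l * v i) (at t)" by (simp add: mult_ac)
      qed
      show "\<exists>v\<in>filippov_set I g t (\<lambda>p. c p * x (t / l) p).
        \<forall>i\<in>I. ((\<lambda>\<tau>. c i * x (\<tau> / l) i) has_real_derivative v i) (at t)"
        by (rule bexI[OF _ member]) (rule velocity)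
    qed
  qed
qed

subsection \<open>Homogeneity of the protocol\<close>

text \<open>The case \<open>e = 0\<close> is included: \<open>sgn\<close> ignores positive factors
  and \<open>r powr 0\<close> is \<open>1\<close>.\<close>

lemma spow_scale: "r > 0 \<Longrightarrow> spow (r * y) e = r powr e * spow y e"
  by (auto simp: spow_def powr_mult abs_mult sgn_mult)

text \<open>Each time derivative costs a factor \<open>1 / l\<close>, so \<open>c\<close> loses one
  power of \<open>l\<close> per order and \<open>c p / l\<close> is precisely the weight of the
  successor component. The coupling term scales alike because \<open>r powr e\<close> contributes
  \<open>l ^ (m - \<mu>)\<close> and the powers of \<open>\<theta>\<close> balance.\<close>

lemma protocol_rhs_rescale:
  assumes "l > 0" "\<theta> > 0" and p: "p \<in> protocol_index m N"
  defines "c \<equiv> \<lambda>p :: nat \<times> nat. l ^ (m + 1 - snd p) / \<theta>"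
  shows "protocol_rhs m N a k (\<lambda>i t. l ^ (m + 1) / \<theta> * \<sigma> i (t / l)) t (\<lambda>p\<in>protocol_index m N. c p * z p) p =
    c p / l * protocol_rhs m N a (\<lambda>\<mu>. \<theta> powr (real (\<mu> + 1) / real (m + 1)) * k \<mu>) \<sigma> (t / l) z p"
proof -
  obtain i \<mu> where [simp]: "p = (i, \<mu>)" by (cases p)
  from p have i: "i \<in> {1..N}" and \<mu>: "\<mu> \<le> m" by (auto simp: protocol_index_def)
  define e where "e = real (m - \<mu>) / real (m + 1)"
  define r where "r = l ^ (m + 1) / \<theta>"
  define \<theta>' where "\<theta>' = \<theta> powr (real (\<mu> + 1) / real (m + 1))"
  define S where "S = (\<Sum>j=1..N. a i j * spow ((\<sigma> i (t / l) - z (i, 0)) - (\<sigma> j (t / l) - z (j, 0))) e)"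
  define Z where "Z = (if \<mu> < m then z (i, \<mu> + 1) else 0)"
  have r: "r > 0" using assms by (simp add: r_def)
  have sum: "(\<Sum>j=1..N. a i j * spow ((r * \<sigma> i (t / l) - r * z (i, 0)) - (r * \<sigma> j (t / l) - r * z (j, 0))) e)
      = r powr e * S"
    unfolding S_def sum_distrib_left
  proof (rule sum.cong)
    fix j
    have "(r * \<sigma> i (t / l) - r * z (i, 0)) - (r * \<sigma> j (t / l) - r * z (j, 0)) =
        r * ((\<sigma> i (t / l) - z (i, 0)) - (\<sigma> j (t / l) - z (j, 0)))"
      by (simp add: algebra_simps)
    then show "a i j * spow ((r * \<sigma> i (t / l) - r * z (i, 0)) - (r * \<sigma> j (t / l) - r * z (j, 0))) e =
        r powr e * (a i j * spow ((\<sigma> i (t / l) - z (i, 0)) - (\<sigma> j (t / l) - z (j, 0))) e)"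
      using spow_scale[OF r] by simp
  qed simp
  have "(l ^ (m + 1)) powr e = l ^ (m - \<mu>)"
  proof -
    have "(l ^ (m + 1)) powr e = l powr (real (m + 1) * e)"
      using \<open>l > 0\<close> by (simp only: powr_realpow[symmetric] powr_powr)
    also have "real (m + 1) * e = real (m - \<mu>)" by (simp add: e_def)
    finally show ?thesis using \<open>l > 0\<close> by (simp add: powr_realpow)
  qed
  then have "r powr e = l ^ (m - \<mu>) / \<theta> powr e"
    using assms by (simp add: r_def powr_divide)
  \<comment> \<open>The exponent \<open>(\<mu> + 1) / (m + 1)\<close> in the gains of the protocol
    is the complement of \<open>e\<close> to \<open>1\<close>.\<close>
  moreover have "\<theta>' * \<theta> powr e = \<theta>"
  proof -
    have "real (\<mu> + 1) / real (m + 1) + e = 1"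
      using \<mu> by (simp add: e_def add_divide_distrib[symmetric])
    then show ?thesis using \<open>\<theta> > 0\<close> unfolding \<theta>'_def powr_add[symmetric] by simp
  qed
  ultimately have powr: "r powr e = l ^ (m - \<mu>) / \<theta> * \<theta>'"
    using \<open>\<theta> > 0\<close> by (auto simp: field_simps) (metis mult.assoc mult.commute)
  have c: "c p / l = l ^ (m - \<mu>) / \<theta>"
    using \<mu> \<open>l > 0\<close> by (simp add: c_def Suc_diff_le)
  have idx: "(j, 0) \<in> protocol_index m N \<longleftrightarrow> j \<in> {1..N}" for j
    by (auto simp: protocol_index_def)
  have "protocol_rhs m N a k (\<lambda>i t. r * \<sigma> i (t / l)) t (\<lambda>p\<in>protocol_index m N. c p * z p) p =
      k \<mu> * (\<Sum>j=1..N. a i j * spow ((r * \<sigma> i (t / l) - r * z (i, 0)) - (r * \<sigma> j (t / l) - r * z (j, 0))) e)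
      + l ^ (m - \<mu>) / \<theta> * Z"
  proof -
    \<comment> \<open>For \<open>\<mu> < m\<close> the weight \<open>c (i, \<mu> + 1)\<close> is
      \<open>l ^ (m - \<mu>) / \<theta>\<close>; for \<open>\<mu> = m\<close> both sides are
      \<open>0\<close>.\<close>
    have "(if \<mu> < m then (\<lambda>p\<in>protocol_index m N. c p * z p) (i, \<mu> + 1) else 0) = l ^ (m - \<mu>) / \<theta> * Z"
      using i by (auto simp: Z_def c_def protocol_index_def)
    moreover have "(\<lambda>p\<in>protocol_index m N. c p * z p) (j, 0) = r * z (j, 0)" if "j \<in> {1..N}" for j
      using that idx by (simp add: c_def r_def)
    ultimately show ?thesis
      using i unfolding protocol_rhs_def e_def by simp
  qed
  also have "\<dots> = k \<mu> * (r powr e * S) + l ^ (m - \<mu>) / \<theta> * Z" by (simp only: sum)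
  also have "\<dots> = c p / l * (\<theta>' * k \<mu> * S + Z)"
    unfolding powr c by (simp add: algebra_simps)
  also have "\<theta>' * k \<mu> * S + Z =
      protocol_rhs m N a (\<lambda>\<mu>. \<theta> powr (real (\<mu> + 1) / real (m + 1)) * k \<mu>) \<sigma> (t / l) z p"
    by (simp add: protocol_rhs_def S_def Z_def \<theta>'_def e_def)
  finally show ?thesis unfolding r_def .
qed

text \<open>The supremum is taken over a bounded set because the derivatives are continuous on a
  compact interval: those of order at most \<open>m\<close> are differentiable, and the one of order
  \<open>m + 1\<close> is continuous by definition.\<close>

lemma modulating_function_le_Sup:
  assumes "modulating_function m \<kappa>" "\<mu> \<le> m + 1" "t \<in> {0..1}"
  shows "\<bar>nderiv \<mu> \<kappa> t\<bar> \<le> (SUP t\<in>{0..1}. \<bar>nderiv \<mu> \<kappa> t\<bar>)"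
proof (rule cSUP_upper[OF assms(3)])
  have "continuous_on {0..} (nderiv \<mu> \<kappa>)"
  proof (cases "\<mu> = m + 1")
    case True
    then show ?thesis using assms by (simp add: modulating_function_def)
  next
    case False
    then show ?thesis using assms
      by (auto simp: modulating_function_def times_differentiable_def
          intro!: differentiable_imp_continuous_on)
  qed
  then have "continuous_on {0..1} (\<lambda>t. \<bar>nderiv \<mu> \<kappa> t\<bar>)"
    by (intro continuous_on_rabs) (auto elim: continuous_on_subset)
  then have "compact ((\<lambda>t. \<bar>nderiv \<mu> \<kappa> t\<bar>) ` {0..1})"
    by (intro compact_continuous_image) auto
  then show "bdd_above ((\<lambda>t. \<bar>nderiv \<mu> \<kappa> t\<bar>) ` {0..1})"
    by (intro bounded_imp_bdd_above compact_imp_bounded)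
qed

theorem theorem1:
  fixes m N :: nat
    and a :: "nat \<Rightarrow> nat \<Rightarrow> real"
    and k K L :: "nat \<Rightarrow> real"
    and \<kappa> :: "real \<Rightarrow> real"
    and \<theta> T_min T_c :: real
    and s \<sigma> :: "nat \<Rightarrow> real \<Rightarrow> real"
    and x :: "real \<Rightarrow> nat \<times> nat \<Rightarrow> real"
  assumes graph: "connected_undirected_graph N a"
    and gains: "edcho_admissible m N a 1 k"
    and modulating: "modulating_function m \<kappa>"
    and K: "\<forall>\<mu>\<le>m + 1. K \<mu> = (SUP t\<in>{0..1}. \<bar>nderiv \<mu> \<kappa> t\<bar>)"
    and L_pos: "\<forall>\<mu>\<le>m + 1. L \<mu> > 0"
    and T_min_pos: "T_min > 0"
    and \<theta>: "\<theta> = (\<Sum>\<nu>=0..m + 1. real ((m + 1) choose \<nu>) * (1 / T_min ^ (m + 1 - \<nu>))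
                  * K (m + 1 - \<nu>) * L \<nu>)"
    and deadline: "T_c \<ge> T_min"
    and signals: "\<forall>i\<in>{1..N}. times_differentiable (m + 1) (s i)"
    and bound_initial: "\<forall>i\<in>{1..N}. \<forall>t\<in>{0..T_c}. \<forall>\<mu>\<le>m + 1.
           \<bar>nderiv \<mu> (average N s) t - nderiv \<mu> (s i) t\<bar> \<le> L \<mu>"
    and bound_final: "\<forall>i\<in>{1..N}. \<forall>t\<ge>T_c.
           \<bar>nderiv (m + 1) (average N s) t - nderiv (m + 1) (s i) t\<bar> \<le> L (m + 1)"
    and \<sigma>: "\<forall>i\<in>{1..N}. \<forall>t\<ge>0. \<sigma> i t = \<kappa> (t / T_c) * s i t"
    and protocol: "filippov_solution (protocol_index m N)
           (protocol_rhs m N a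
             (\<lambda>\<mu>. \<theta> powr (real (\<mu> + 1) / real (m + 1)) * k \<mu>) \<sigma>) x"
    and initial: "\<forall>i\<in>{1..N}. \<forall>\<mu>\<le>m. x 0 (i, \<mu>) = 0"
  shows "\<forall>t\<ge>T_c. \<forall>i\<in>{1..N}. \<forall>\<mu>\<le>m.
           protocol_output \<sigma> x i \<mu> t = nderiv \<mu> (average N s) t"
proof -

  \<comment> \<open>Derivatives of the modulated signals and of their average\<close>
  let ?s = "average N s" and ?\<sigma> = "average N \<sigma>"
  \<comment> \<open>The factor \<open>1\<close> gives the shape of \<open>nderiv_rescale\<close>
    with \<open>r = 1\<close>.\<close>
  define \<kappa>c where "\<kappa>c t = 1 * \<kappa> (t / T_c)" for t
  have Tc: "T_c > 0" using deadline T_min_pos by simp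
  have \<kappa>_diff: "times_differentiable (m + 1) \<kappa>" and \<kappa>_0: "\<kappa> 0 = 0" and \<kappa>_1: "\<forall>t\<ge>1. \<kappa> t = 1"
    and \<kappa>_flat: "\<forall>\<mu>\<in>{1..m}. nderiv \<mu> \<kappa> 0 = 0 \<and> nderiv \<mu> \<kappa> 1 = 0"
    using modulating by (auto simp: modulating_function_def)
  have \<kappa>c_diff: "times_differentiable (m + 1) \<kappa>c"
    and \<kappa>c: "\<And>\<mu> t. \<mu> \<le> m + 1 \<Longrightarrow> t \<ge> 0 \<Longrightarrow> nderiv \<mu> \<kappa>c t = 1 / T_c ^ \<mu> * nderiv \<mu> \<kappa> (t / T_c)"
    unfolding \<kappa>c_def using nderiv_rescale[OF \<kappa>_diff Tc] by blast+
  have s_diff: "times_differentiable (m + 1) ?s" by (rule nderiv_average(2)[OF signals])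
  have \<sigma>_prod: "\<sigma> i t = \<kappa>c t * s i t" if "i \<in> {1..N}" "t \<ge> 0" for i t
    using \<sigma> that by (simp add: \<kappa>c_def)
  \<comment> \<open>The modulating factor is common to all agents, so it commutes with
    averaging.\<close>
  have avg_prod: "?\<sigma> t = \<kappa>c t * ?s t" if "t \<ge> 0" for t
    using \<sigma>_prod that by (simp add: average_def sum_distrib_left mult_ac)
  have \<sigma>_diff: "times_differentiable (m + 1) (\<sigma> i)" if "i \<in> {1..N}" for i
    using nderiv_mult(2)[OF \<kappa>c_diff _ \<sigma>_prod[OF that]] signals that by blast
  have avg_diff: "times_differentiable (m + 1) ?\<sigma>"
    by (rule nderiv_mult(2)[OF \<kappa>c_diff s_diff avg_prod])
  have leibniz: "nderiv \<mu> (\<sigma> i) t = (\<Sum>\<nu>\<le>\<mu>. real (\<mu> choose \<nu>) * (nderiv (\<mu> - \<nu>) \<kappa>c t * nderiv \<nu> (s i) t))"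
    if "i \<in> {1..N}" "\<mu> \<le> m + 1" "t \<ge> 0" for i \<mu> t
    using nderiv_mult(1)[OF \<kappa>c_diff _ \<sigma>_prod[OF that(1)]] signals that by blast
  have leibniz_avg: "nderiv \<mu> ?\<sigma> t = (\<Sum>\<nu>\<le>\<mu>. real (\<mu> choose \<nu>) * (nderiv (\<mu> - \<nu>) \<kappa>c t * nderiv \<nu> ?s t))"
    if "\<mu> \<le> m + 1" "t \<ge> 0" for \<mu> t
    using nderiv_mult(1)[OF \<kappa>c_diff s_diff avg_prod] that by blast
  \<comment> \<open>At \<open>t = T_c\<close> itself only the orders up to \<open>m\<close> are
    covered, by the flatness of \<open>\<kappa>\<close> at \<open>1\<close>; the order
    \<open>m + 1\<close> is treated where \<open>\<kappa>c\<close> is locally constant, hence the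
    last condition.\<close>
  have \<kappa>c_final: "nderiv n \<kappa>c t = (if n = 0 then 1 else 0)" if nt: "n \<le> m + 1" "t \<ge> T_c" "n \<le> m \<or> t > T_c" for n t
  proof -
    consider "n = 0" | "n > 0" "t > T_c" | "n \<in> {1..m}" "t = T_c"
      using nt by fastforce
    then have "nderiv n \<kappa> (t / T_c) = (if n = 0 then 1 else 0)"
    proof cases
      case 1
      then show ?thesis using nt Tc \<kappa>_1 by simp
    next
      case 2
      then show ?thesis using Tc nderiv_eventually_const[OF \<kappa>_1, of "t / T_c" n] by simp
    next
      case 3
      then show ?thesis using Tc \<kappa>_flat by auto
    qed
    then show ?thesis using \<kappa>c[of n t] nt Tc by simp
  qed
  \<comment> \<open>In a Leibniz sum past the deadline only the term \<open>\<nu> = \<mu>\<close>,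
    with undifferentiated modulating factor \<open>1\<close>, survives.\<close>
  have collapse: "(\<Sum>\<nu>\<le>\<mu>. real (\<mu> choose \<nu>) * (nderiv (\<mu> - \<nu>) \<kappa>c t * g \<nu>)) = g \<mu>"
    if "\<mu> \<le> m + 1" "t \<ge> T_c" "\<mu> \<le> m \<or> t > T_c" for \<mu> t and g :: "nat \<Rightarrow> real"
  proof -
    have "(\<Sum>\<nu>\<le>\<mu>. real (\<mu> choose \<nu>) * (nderiv (\<mu> - \<nu>) \<kappa>c t * g \<nu>)) = (\<Sum>\<nu>\<le>\<mu>. if \<nu> = \<mu> then g \<mu> else 0)"
    proof (rule sum.cong)
      fix \<nu> assume "\<nu> \<in> {..\<mu>}"
      then have "nderiv (\<mu> - \<nu>) \<kappa>c t = (if \<nu> = \<mu> then 1 else 0)"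
        using that by (subst \<kappa>c_final) auto
      then show "real (\<mu> choose \<nu>) * (nderiv (\<mu> - \<nu>) \<kappa>c t * g \<nu>) = (if \<nu> = \<mu> then g \<mu> else 0)"
        by simp
    qed simp
    then show ?thesis by simp
  qed
  have avg_final: "nderiv \<mu> ?\<sigma> t = nderiv \<mu> ?s t" if "\<mu> \<le> m + 1" "t \<ge> T_c" "\<mu> \<le> m \<or> t > T_c" for \<mu> t
    using leibniz_avg[of \<mu> t] collapse[OF that] that Tc by simp
  have \<sigma>_final: "nderiv (m + 1) (\<sigma> i) t = nderiv (m + 1) (s i) t" if "i \<in> {1..N}" "t > T_c" for i t
    using leibniz[OF that(1) order_refl, of t] collapse[of "m + 1" t] that Tc by simp

  \<comment> \<open>Positivity of \<open>\<theta>\<close> and the bound on the top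
    derivatives\<close>
  have K_bound: "\<bar>nderiv \<mu> \<kappa> t\<bar> \<le> K \<mu>" if "\<mu> \<le> m + 1" "t \<in> {0..1}" for \<mu> t
    using modulating_function_le_Sup[OF modulating that] K that by simp
  have K_nonneg: "K \<mu> \<ge> 0" if "\<mu> \<le> m + 1" for \<mu>
    using K_bound[OF that, of 0] by simp
  have K_0: "K 0 \<ge> 1" using K_bound[of 0 1] \<kappa>_1 by simp
  \<comment> \<open>All summands of \<open>\<theta>\<close> are nonnegative, and the one for
    \<open>\<nu> = m + 1\<close> is \<open>K 0 * L (m + 1)\<close>, which is at least
    \<open>L (m + 1)\<close> since \<open>\<kappa>\<close> takes the value \<open>1\<close>.\<close>
  have "(\<Sum>\<nu>\<in>{m + 1}. real ((m + 1) choose \<nu>) * (1 / T_min ^ (m + 1 - \<nu>)) * K (m + 1 - \<nu>) * L \<nu>) \<le> \<theta>"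
    unfolding \<theta>
    by (rule sum_mono2) (use K_nonneg L_pos T_min_pos in \<open>auto intro!: mult_nonneg_nonneg less_imp_le[of 0 "L _"]\<close>)
  moreover have "1 * L (m + 1) \<le> K 0 * L (m + 1)"
    by (rule mult_right_mono) (use K_0 L_pos in \<open>simp_all add: less_imp_le\<close>)
  ultimately have L_le: "L (m + 1) \<le> \<theta>" by simp
  then have \<theta>_pos: "\<theta> > 0" using L_pos[rule_format, of "m + 1"] by simp

  have error: "\<bar>nderiv (m + 1) ?\<sigma> t - nderiv (m + 1) (\<sigma> i) t\<bar> \<le> \<theta>" if i: "i \<in> {1..N}" and "t \<ge> 0" for i t
  \<comment> \<open>The instant \<open>T_c\<close> belongs to the first case: derivatives of order
    \<open>m + 1\<close> are identified with those of \<open>s\<close> only for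
    \<open>t > T_c\<close>.\<close>
  proof (cases "t \<le> T_c")
    case True
    define b where "b \<nu> = real ((m + 1) choose \<nu>)" for \<nu>
    \<comment> \<open>Both Leibniz expansions carry the same factors of \<open>\<kappa>c\<close>, so
      their difference involves \<open>s\<close> only through its deviations from the average, which
      \<open>L\<close> bounds.\<close>
    have difference: "nderiv (m + 1) ?\<sigma> t - nderiv (m + 1) (\<sigma> i) t =
        (\<Sum>\<nu>\<le>m + 1. b \<nu> * (nderiv (m + 1 - \<nu>) \<kappa>c t * (nderiv \<nu> ?s t - nderiv \<nu> (s i) t)))"
      unfolding leibniz[OF i order_refl \<open>t \<ge> 0\<close>] leibniz_avg[OF order_refl \<open>t \<ge> 0\<close>]
        sum_subtractf[symmetric] b_def[symmetric]
      by (simp only: right_diff_distrib)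
    show ?thesis
      unfolding difference \<theta> atLeast0AtMost b_def[symmetric]
    proof (rule order_trans[OF sum_abs sum_mono])
      fix \<nu> assume \<nu>: "\<nu> \<in> {..m + 1}"
      have tT: "t / T_c \<in> {0..1}" using True \<open>t \<ge> 0\<close> Tc by simp
      have "\<bar>nderiv (m + 1 - \<nu>) \<kappa>c t\<bar> = 1 / T_c ^ (m + 1 - \<nu>) * \<bar>nderiv (m + 1 - \<nu>) \<kappa> (t / T_c)\<bar>"
        using Tc \<open>t \<ge> 0\<close> by (subst \<kappa>c) (simp_all add: abs_mult)
      \<comment> \<open>Here \<open>T_c \<ge> T_min\<close> makes one \<open>\<theta>\<close> serve
        all deadlines.\<close>
      also have "\<dots> \<le> 1 / T_min ^ (m + 1 - \<nu>) * K (m + 1 - \<nu>)"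
        using deadline T_min_pos Tc K_bound[OF _ tT, of "m + 1 - \<nu>"]
        by (intro mult_mono divide_left_mono power_mono) auto
      finally have "\<bar>nderiv (m + 1 - \<nu>) \<kappa>c t\<bar> \<le> 1 / T_min ^ (m + 1 - \<nu>) * K (m + 1 - \<nu>)" .
      moreover have "\<bar>nderiv \<nu> ?s t - nderiv \<nu> (s i) t\<bar> \<le> L \<nu>"
        using bound_initial i \<nu> \<open>t \<ge> 0\<close> True by auto
      ultimately have "\<bar>nderiv (m + 1 - \<nu>) \<kappa>c t\<bar> * \<bar>nderiv \<nu> ?s t - nderiv \<nu> (s i) t\<bar>
          \<le> 1 / T_min ^ (m + 1 - \<nu>) * K (m + 1 - \<nu>) * L \<nu>"
        by (intro mult_mono) auto
      from mult_left_mono[OF this, of "b \<nu>"]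
      show "\<bar>b \<nu> * (nderiv (m + 1 - \<nu>) \<kappa>c t * (nderiv \<nu> ?s t - nderiv \<nu> (s i) t))\<bar>
          \<le> b \<nu> * (1 / T_min ^ (m + 1 - \<nu>)) * K (m + 1 - \<nu>) * L \<nu>"
        unfolding abs_mult by (simp only: mult.assoc b_def abs_of_nat of_nat_0_le_iff)
    qed
  next
    case False
    then have "t > T_c" by simp
    then have "\<bar>nderiv (m + 1) ?s t - nderiv (m + 1) (s i) t\<bar> \<le> L (m + 1)"
      using bound_final i by simp
    also note L_le
    finally show ?thesis
      using avg_final[of "m + 1" t] \<sigma>_final[OF i] \<open>t > T_c\<close> by simp
  qed

  \<comment> \<open>Convergence of the rescaled trajectory\<close>
  obtain T where "T > 0" and T: "\<forall>\<sigma> x.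
        (\<forall>i\<in>{1..N}. times_differentiable (m + 1) (\<sigma> i)) \<and>
        (\<forall>t\<ge>0. \<forall>i\<in>{1..N}.
           \<bar>nderiv (m + 1) (average N \<sigma>) t - nderiv (m + 1) (\<sigma> i) t\<bar> \<le> 1) \<and>
        filippov_solution (protocol_index m N) (protocol_rhs m N a k \<sigma>) x \<and>
        (\<forall>\<mu>\<le>m. (\<Sum>i=1..N. x 0 (i, \<mu>)) = 0) \<and>
        (\<forall>i\<in>{1..N}. \<forall>\<mu>\<le>m. protocol_output \<sigma> x i \<mu> 0 = 0) \<longrightarrow>
        (\<forall>t\<ge>T. \<forall>i\<in>{1..N}. \<forall>\<mu>\<le>m. protocol_output \<sigma> x i \<mu> t = nderiv \<mu> (average N \<sigma>) t)"
    using gains[unfolded edcho_admissible_def, THEN conjunct2, THEN spec, of "\<lambda>_ _. 0"]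
    by (elim exE conjE) (rule that)
  \<comment> \<open>\<open>T\<close> was obtained for zero initial outputs before any signals were
    fixed, so the scale may depend on it; this choice sends the time \<open>T_c\<close> to
    \<open>l * T_c = T\<close>.\<close>
  define l where "l = T / T_c"
  have l: "l > 0" using \<open>T > 0\<close> Tc by (simp add: l_def)
  define c where "c p = l ^ (m + 1 - snd p) / \<theta>" for p :: "nat \<times> nat"
  have c: "c p > 0" for p using l \<theta>_pos by (simp add: c_def)
  define r where "r = l ^ (m + 1) / \<theta>"
  \<comment> \<open>The order \<open>m + 1\<close> is included although it is no state index: it is
    needed for the top derivatives. The index \<open>i\<close> is arbitrary since \<open>c\<close>
    depends on the order only.\<close>
  have r_div: "r / l ^ \<mu> = c (i, \<mu>)" if "\<mu> \<le> m + 1" for i \<mu>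
    using that l \<theta>_pos by (simp add: r_def c_def power_diff)
  let ?\<sigma>' = "\<lambda>i t. r * \<sigma> i (t / l)" and ?x' = "\<lambda>t p. c p * x (t / l) p"
  have avg': "average N ?\<sigma>' = (\<lambda>t. r * ?\<sigma> (t / l))"
    by (auto simp: average_def sum_distrib_left mult_ac)
  have \<sigma>': "nderiv \<mu> (?\<sigma>' i) t = c (i, \<mu>) * nderiv \<mu> (\<sigma> i) (t / l)"
    if "i \<in> {1..N}" "\<mu> \<le> m + 1" "t \<ge> 0" for i \<mu> t
    unfolding r_div[OF that(2), symmetric] by (rule nderiv_rescale(1)[OF \<sigma>_diff[OF that(1)] l that(2,3)])
  have avg'_nderiv: "nderiv \<mu> (average N ?\<sigma>') t = c (i, \<mu>) * nderiv \<mu> ?\<sigma> (t / l)"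
    if "\<mu> \<le> m + 1" "t \<ge> 0" for i \<mu> t
    unfolding avg' r_div[OF that(1), symmetric] by (rule nderiv_rescale(1)[OF avg_diff l that])
  have conv: "\<forall>t\<ge>T. \<forall>i\<in>{1..N}. \<forall>\<mu>\<le>m.
      protocol_output ?\<sigma>' ?x' i \<mu> t = nderiv \<mu> (average N ?\<sigma>') t"
  proof (rule T[THEN spec, of ?\<sigma>', THEN spec, of ?x', THEN mp], intro conjI)
    show "\<forall>i\<in>{1..N}. times_differentiable (m + 1) (?\<sigma>' i)"
      using nderiv_rescale(2)[OF \<sigma>_diff l] by blast
    show "\<forall>t\<ge>0. \<forall>i\<in>{1..N}. \<bar>nderiv (m + 1) (average N ?\<sigma>') t - nderiv (m + 1) (?\<sigma>' i) t\<bar> \<le> 1"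
    proof (intro allI impI ballI)
      fix t :: real and i assume t: "t \<ge> 0" and i: "i \<in> {1..N}"
      \<comment> \<open>The power of \<open>l\<close> is \<open>0\<close> at this order, so the
        deviation bound \<open>\<theta>\<close> becomes \<open>1\<close> whatever \<open>l\<close>
        is.\<close>
      have "c (i, m + 1) = 1 / \<theta>" by (simp add: c_def)
      then have "nderiv (m + 1) (average N ?\<sigma>') t - nderiv (m + 1) (?\<sigma>' i) t =
          (nderiv (m + 1) ?\<sigma> (t / l) - nderiv (m + 1) (\<sigma> i) (t / l)) / \<theta>"
        unfolding \<sigma>'[OF i order_refl t] avg'_nderiv[OF order_refl t, of i]
        by (simp add: diff_divide_distrib)
      then show "\<bar>nderiv (m + 1) (average N ?\<sigma>') t - nderiv (m + 1) (?\<sigma>' i) t\<bar> \<le> 1"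
        using error[OF i, of "t / l"] t l \<theta>_pos by simp
    qed
    show "filippov_solution (protocol_index m N) (protocol_rhs m N a k ?\<sigma>') ?x'"
    proof (rule filippov_solution_rescale[OF _ l c protocol])
      show "finite (protocol_index m N)" by (simp add: protocol_index_def)
    qed (use protocol_rhs_rescale[OF l \<theta>_pos] in \<open>simp add: r_def c_def\<close>)
    show "\<forall>\<mu>\<le>m. (\<Sum>i=1..N. ?x' 0 (i, \<mu>)) = 0"
      by (intro allI impI sum.neutral ballI) (simp add: initial)
    show "\<forall>i\<in>{1..N}. \<forall>\<mu>\<le>m. protocol_output ?\<sigma>' ?x' i \<mu> 0 = 0"
    proof (intro ballI allI impI)
      fix i \<mu> assume i: "i \<in> {1..N}" and \<mu>: "\<mu> \<le> m"
      \<comment> \<open>Order \<open>0\<close> comes from \<open>\<kappa> 0 = 0\<close>, the others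
        from flatness at \<open>0\<close>; thus every Leibniz term of \<open>\<sigma> i\<close> at
        \<open>0\<close> vanishes, whatever the signal.\<close>
      have "nderiv n \<kappa>c 0 = 0" if "n \<le> m" for n
        using \<kappa>c[of n 0] \<kappa>_flat \<kappa>_0 that by (cases "n = 0") auto
      then have "nderiv \<mu> (\<sigma> i) 0 = 0"
        using leibniz[OF i, of \<mu> 0] \<mu> by simp
      then show "protocol_output ?\<sigma>' ?x' i \<mu> 0 = 0"
        using \<sigma>'[OF i, of \<mu> 0] \<mu> i initial by (simp add: protocol_output_def)
    qed
  qed

  \<comment> \<open>Return to the original time scale\<close>
  show ?thesis
  proof (intro allI impI ballI)
    fix t i \<mu> assume t: "t \<ge> T_c" and i: "i \<in> {1..N}" and \<mu>: "\<mu> \<le> m"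
    have "l * t \<ge> l * T_c" by (rule mult_left_mono) (use l t in auto)
    then have lt: "l * t \<ge> T" using Tc by (simp add: l_def)
    then have lt0: "l * t \<ge> 0" using \<open>T > 0\<close> by simp
    \<comment> \<open>Output and average derivative at time \<open>l * t\<close> carry the same
      positive factor \<open>c (i, \<mu>)\<close>, which cancels at the end.\<close>
    have "c (i, \<mu>) * protocol_output \<sigma> x i \<mu> t = protocol_output ?\<sigma>' ?x' i \<mu> (l * t)"
      using \<sigma>'[OF i _ lt0, of \<mu>] \<mu> l by (simp add: protocol_output_def right_diff_distrib)
    also have "\<dots> = nderiv \<mu> (average N ?\<sigma>') (l * t)"
      using conv lt i \<mu> by blast
    also have "\<dots> = c (i, \<mu>) * nderiv \<mu> ?\<sigma> t"
      using avg'_nderiv[OF _ lt0, of \<mu> i] \<mu> l by simp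
    also have "nderiv \<mu> ?\<sigma> t = nderiv \<mu> ?s t"
      using avg_final \<mu> t by simp
    finally show "protocol_output \<sigma> x i \<mu> t = nderiv \<mu> ?s t"
      using c[of "(i, \<mu>)"] by simp
  qed
qed

end
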